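(* Let $p>2$ be a prime. Then $p$ is a twin prime (that is, $p+2$ is also prime) if and only if $\xi(p)=\xi(p+2)$.
   Context: For an integer $n\ge 1$ put $\iota(n)=(-1)^{\pi(n)}$, where $\pi(n)$ is the number of primes $\le n$. For real $x\ge 1$ put $\xi(x)=\sum_{n\le x}\iota(n)$, the sum running over integers $1\le n\le x$. Here a prime $p$ is called a twin prime if $p+2$ is also prime. *)

theory Defs
  imports Complex_Main "HOL-Computational_Algebra.Primes"
begin

definition prime_count :: "nat \<Rightarrow> nat"
  where "prime_count n = card {q. prime q \<and> q \<le> n}"

definition iota :: "nat \<Rightarrow> int"
  where "iota n = (- 1) ^ prime_count n"

definition xi :: "real \<Rightarrow> int"
  where "xi x = (\<Sum>n \<in> {n::nat. 1 \<le> n \<and> real n \<le> x}. iota n)"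

definition twin_prime :: "nat \<Rightarrow> bool"
  where "twin_prime p \<longleftrightarrow> prime p \<and> prime (p + 2)"

end

theory Submission
  imports Defs
begin

text \<open>
  For an odd prime \<open>p\<close> the number \<open>p + 1\<close> is composite, so \<open>\<iota>(p + 1) = \<iota>(p)\<close>, and
  \<open>\<xi>(p + 2) - \<xi>(p) = \<iota>(p + 1) + \<iota>(p + 2)\<close> vanishes exactly when the sign flips at \<open>p + 2\<close>,
  i.e. when \<open>p + 2\<close> is prime.
\<close>

lemma prime_count_Suc:
  "prime_count (Suc n) = prime_count n + (if prime (Suc n) then 1 else 0)"
proof -
  have "{q. prime q \<and> q \<le> Suc n} =
      (if prime (Suc n) then insert (Suc n) {q. prime q \<and> q \<le> n} else {q. prime q \<and> q \<le> n})"
    by (auto simp: le_Suc_eq)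
  then show ?thesis
    by (simp add: prime_count_def)
qed

lemma iota_Suc: "iota (Suc n) = (if prime (Suc n) then - iota n else iota n)"
  by (simp add: iota_def prime_count_Suc)

text \<open>Needed for the converse direction: two equal consecutive signs must not cancel.\<close>

lemma iota_nonzero: "iota n \<noteq> 0"
  by (simp add: iota_def)

text \<open>At integer arguments the real cutoff becomes a \<open>nat\<close> interval, from which
  the top terms can be split off.\<close>

lemma xi_of_nat: "xi (real n) = (\<Sum>k = 1..n. iota k)"
  by (simp add: xi_def atLeastAtMost_def atLeast_def atMost_def Collect_conj_eq)

theorem lemma5p4:
  fixes p :: nat
  assumes "prime p" and "p > 2"
  shows "twin_prime p \<longleftrightarrow> xi (real p) = xi (real (p + 2))"
proof -
  have "odd p"
    using assms by (simp add: prime_odd_nat)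
  \<comment> \<open>\<open>Suc p\<close> is even and exceeds 2.\<close>
  then have "\<not> prime (Suc p)"
    using assms prime_odd_nat[of "Suc p"] by auto
  moreover have "xi (real (p + 2)) = xi (real p) + iota (Suc p) + iota (Suc (Suc p))"
    unfolding xi_of_nat by simp
  \<comment> \<open>The two added terms sum to 0 if \<open>p + 2\<close> is prime and to
    \<open>2 * iota p\<close>, which is nonzero, otherwise.\<close>
  ultimately show ?thesis
    using assms iota_nonzero[of p] by (simp add: twin_prime_def iota_Suc)
qed

end
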